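(* For every positive integer $n$, there is exactly one ballot permutation of length $n$ avoiding both patterns $132$ and $231$, i.e. $|B_n(132,231)|=1$.
   Context: A permutation $\sigma\in S_n$ is written as $\sigma(1)\cdots\sigma(n)$. An index $i\in[n-1]$ is an ascent if $\sigma(i)<\sigma(i+1)$ and a descent if $\sigma(i)>\sigma(i+1)$. A ballot permutation is a permutation such that every prefix $\sigma(1)\cdots\sigma(p)$ has at least as many ascents as descents. $\sigma$ contains a pattern $\pi\in S_k$ if some subsequence $\sigma(c_1)\cdots\sigma(c_k)$ with $c_1<\dots<c_k$ is order-isomorphic to $\pi$, and avoids $\pi$ otherwise. $B_n(\pi_1,\dots,\pi_m)$ denotes the set of ballot permutations of length $n$ avoiding all of $\pi_1,\dots,\pi_m$. *)

theory Defs
  imports "HOL-Combinatorics.Multiset_Permutations" "HOL-Library.Sublist"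
begin

text \<open>
  A permutation of \<open>{1..n}\<close> is represented by its one-line notation, the list
  \<open>[\<sigma>(1), \<dots>, \<sigma>(n)]\<close>. List positions count from 0, so \<open>xs ! i\<close> is \<open>\<sigma>(i + 1)\<close>.
\<close>

definition perms :: "nat \<Rightarrow> nat list set" where
  "perms n = permutations_of_set {1..n}"

definition ascents :: "nat list \<Rightarrow> nat set" where
  "ascents xs = {i. Suc i < length xs \<and> xs ! i < xs ! Suc i}"

definition descents :: "nat list \<Rightarrow> nat set" where
  "descents xs = {i. Suc i < length xs \<and> xs ! i > xs ! Suc i}"

definition ballot :: "nat list \<Rightarrow> bool" where
  "ballot xs \<longleftrightarrow> (\<forall>ys. prefix ys xs \<longrightarrow> card (descents ys) \<le> card (ascents ys))"

definition order_isomorphic :: "nat list \<Rightarrow> nat list \<Rightarrow> bool" where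
  "order_isomorphic xs ys \<longleftrightarrow> length xs = length ys \<and>
     (\<forall>i < length xs. \<forall>j < length xs. xs ! i < xs ! j \<longleftrightarrow> ys ! i < ys ! j)"

definition contains :: "nat list \<Rightarrow> nat list \<Rightarrow> bool" where
  "contains xs p \<longleftrightarrow> (\<exists>ys. subseq ys xs \<and> order_isomorphic ys p)"

definition avoids :: "nat list \<Rightarrow> nat list \<Rightarrow> bool" where
  "avoids xs p \<longleftrightarrow> \<not> contains xs p"

definition ballot_perms :: "nat \<Rightarrow> nat list set \<Rightarrow> nat list set" where
  "ballot_perms n P = {xs \<in> perms n. ballot xs \<and> (\<forall>p \<in> P. avoids xs p)}"

end

theory Submission
  imports Defs
begin

text \<open>
  Avoiding both 132 and 231 means that no entry exceeds both an earlier and a later one, so an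
  ascent is never followed by a descent. The ballot condition on the prefix of length two makes the
  first step an ascent; hence every step is one, and the permutation is the identity.
\<close>

text \<open>This turns pattern matching for triples into propositional reasoning. Entries may tie,
  so both strict directions of each pair are kept; diagonal pairs are trivial.\<close>

lemma order_isomorphic_3:
  "order_isomorphic [a, b, c] [x, y, z] \<longleftrightarrow>
     (a < b \<longleftrightarrow> x < y) \<and> (b < a \<longleftrightarrow> y < x) \<and> (a < c \<longleftrightarrow> x < z) \<and>
     (c < a \<longleftrightarrow> z < x) \<and> (b < c \<longleftrightarrow> y < z) \<and> (c < b \<longleftrightarrow> z < y)"
  unfolding order_isomorphic_def by (auto simp: less_Suc_eq numeral_3_eq_3)

lemma subseq_three_consecutive:
  assumes "Suc (Suc i) < length xs"
  shows "subseq [xs ! i, xs ! Suc i, xs ! Suc (Suc i)] xs"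
proof -
  have "drop i xs = [xs ! i, xs ! Suc i, xs ! Suc (Suc i)] @ drop (Suc (Suc (Suc i))) xs"
    using assms by (simp add: Cons_nth_drop_Suc)
  then have "xs = take i xs @ [xs ! i, xs ! Suc i, xs ! Suc (Suc i)] @ drop (Suc (Suc (Suc i))) xs"
    by (metis append_take_drop_id)
  then show ?thesis
    by (metis sublist_appendI sublist_imp_subseq)
qed

lemma ascent_not_followed_by_descent:
  assumes "distinct xs" "avoids xs [1, 3, 2]" "avoids xs [2, 3, 1]"
    and i: "Suc (Suc i) < length xs" and asc: "xs ! i < xs ! Suc i"
  shows "xs ! Suc i < xs ! Suc (Suc i)"
proof (rule ccontr)
  let ?ys = "[xs ! i, xs ! Suc i, xs ! Suc (Suc i)]"
  assume "\<not> ?thesis"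
  moreover have "xs ! Suc i \<noteq> xs ! Suc (Suc i)" "xs ! i \<noteq> xs ! Suc (Suc i)"
    using assms(1) i by (simp_all add: nth_eq_iff_index_eq)
  \<comment> \<open>The middle entry is a strict peak, so the outer two decide the pattern: 132 if
    the first is smaller, 231 if the last is.\<close>
  ultimately have "order_isomorphic ?ys [1, 3, 2] \<or> order_isomorphic ?ys [2, 3, 1]"
    using asc unfolding order_isomorphic_3 by auto
  then show False
    using assms(2,3) subseq_three_consecutive[OF i] unfolding avoids_def contains_def by blast
qed

lemma ballot_first_step:
  assumes "ballot xs" "distinct xs" "1 < length xs"
  shows "xs ! 0 < xs ! 1"
proof (rule ccontr)
  assume "\<not> ?thesis"
  moreover have "xs ! 0 \<noteq> xs ! 1"
    using assms(2,3) by (subst nth_eq_iff_index_eq) auto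
  ultimately have "xs ! 1 < xs ! 0" by linarith
  \<comment> \<open>This prefix has exactly two entries, so 0 is its only possible ascent or
    descent, and the ballot inequality would read 1 \<le> 0.\<close>
  then have "descents (take 2 xs) = {0}" "ascents (take 2 xs) = {}"
    using assms(3) unfolding descents_def ascents_def by (auto simp: less_Suc_eq)
  moreover have "card (descents (take 2 xs)) \<le> card (ascents (take 2 xs))"
    using assms(1) take_is_prefix unfolding ballot_def by blast
  ultimately show False by simp
qed

lemma sorted_if_ballot_avoiding:
  assumes "distinct xs" "ballot xs" "avoids xs [1, 3, 2]" "avoids xs [2, 3, 1]"
  shows "sorted xs"
proof -
  \<comment> \<open>The induction carries strict ascents because the step turns one strict ascent
    into the next.\<close>
  have "xs ! i < xs ! Suc i" if "Suc i < length xs" for i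
    using that
  proof (induction i)
    case 0
    then show ?case using ballot_first_step assms by simp
  next
    case (Suc i)
    then show ?case using ascent_not_followed_by_descent assms by simp
  qed
  then show ?thesis by (simp add: sorted_iff_nth_Suc less_imp_le)
qed

lemma sorted_subseq:
  "subseq ys xs \<Longrightarrow> sorted xs \<Longrightarrow> sorted ys"
  by (induction rule: list_emb.induct) (auto dest: list_emb_set)

text \<open>Prefixes inherit sortedness, so each has 0 descents and the inequality is
  trivial.\<close>

lemma ballot_sorted:
  assumes "sorted xs"
  shows "ballot xs"
  unfolding ballot_def
proof (intro allI impI)
  fix ys assume "prefix ys xs"
  then have "sorted ys"
    using assms by (auto simp: prefix_def sorted_append)
  then have "descents ys = {}"
    unfolding descents_def sorted_iff_nth_Suc by (auto simp: not_less)
  then show "card (descents ys) \<le> card (ascents ys)" by simp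
qed

text \<open>An occurrence of \<open>p\<close> would carry its inversion at \<open>i\<close>,
  \<open>j\<close> over to a subsequence of \<open>xs\<close>, which is itself sorted.\<close>

lemma sorted_avoids:
  assumes "sorted xs" "i < j" "j < length p" "p ! j < p ! i"
  shows "avoids xs p"
  unfolding avoids_def contains_def
proof safe
  fix ys assume ys: "subseq ys xs" "order_isomorphic ys p"
  then have "ys ! j < ys ! i" "j < length ys"
    using assms(2-4) unfolding order_isomorphic_def by auto
  moreover have "sorted ys"
    using ys(1) assms(1) by (rule sorted_subseq)
  ultimately show False
    using assms(2) sorted_nth_mono[of ys i j] by simp
qed

theorem theorem3p9:
  fixes n :: nat
  assumes "n \<ge> 1"
  shows "card (ballot_perms n {[1, 3, 2], [2, 3, 1]}) = 1"
proof -
  have "ballot_perms n {[1, 3, 2], [2, 3, 1]} = {[1..<Suc n]}"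
  proof (intro equalityI subsetI)
    fix xs assume "xs \<in> ballot_perms n {[1, 3, 2], [2, 3, 1]}"
    then have xs: "set xs = {1..n}" "distinct xs" and "sorted xs"
      using sorted_if_ballot_avoiding
      by (auto simp: ballot_perms_def perms_def permutations_of_set_def)
    \<comment> \<open>A finite set has only one sorted distinct enumeration. Deleting
      \<open>upt_Suc\<close> keeps the interval from being split at its last entry.\<close>
    then have "xs = [1..<Suc n]"
      by (intro sorted_distinct_set_unique) (auto simp del: upt_Suc)
    then show "xs \<in> {[1..<Suc n]}" by simp
  next
    fix xs assume "xs \<in> {[1..<Suc n]}"
    then have xs: "xs = [1..<Suc n]" by simp
    then have sorted: "sorted xs" by (simp del: upt_Suc)
    have "xs \<in> perms n"
      unfolding xs perms_def permutations_of_set_def by (auto simp del: upt_Suc)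
    \<comment> \<open>Counting from 0, positions 1 and 2 hold the final descent of either pattern: 3
      then 2, and 3 then 1.\<close>
    moreover have "avoids xs [1, 3, 2]"
      by (rule sorted_avoids[OF sorted, of 1 2]) auto
    moreover have "avoids xs [2, 3, 1]"
      by (rule sorted_avoids[OF sorted, of 1 2]) auto
    ultimately show "xs \<in> ballot_perms n {[1, 3, 2], [2, 3, 1]}"
      using ballot_sorted[OF sorted] by (simp add: ballot_perms_def)
  qed
  then show ?thesis by simp
qed

end
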